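(* Let $n\ge 2$ be an integer, let $u>0$, and let $\mathcal P=\{(x,y,z)\in\mathbb{R}^{n-2}\times\mathbb{R}_+\times\mathbb{R}_+ : \|x\|^2\le 2yz,\ z\le u\}$. A point $(\hat x,\hat y,\hat z)\in\mathbb{R}^{n-2}\times\mathbb{R}\times\mathbb{R}$ satisfies $\|\hat x\|^2\le 2u\hat y$ and $u\le\hat z$ if and only if $P_{\mathcal P}(\hat x,\hat y,\hat z)=(\hat x,\hat y,u)$.
   Context: $\|\cdot\|$ is the Euclidean norm. $P_{\mathcal P}(\mathsf w)$ denotes the Euclidean projection of $\mathsf w\in\mathbb{R}^n$ onto the closed convex set $\mathcal P$, i.e. the unique minimizer of $\|\mathsf v-\mathsf w\|$ over $\mathsf v\in\mathcal P$. Points of $\mathbb{R}^n$ are written $(x,y,z)$ with $x\in\mathbb{R}^{n-2}$ and $y,z\in\mathbb{R}$. *)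

theory Defs
  imports "HOL-Analysis.Analysis"
begin

text \<open>
  The space \<open>\<real>\<^sup>n\<close> with \<open>n \<ge> 2\<close> is \<open>real ^ 'n\<close> together with two distinct indices \<open>p\<close> and \<open>q\<close>:
  a vector \<open>w\<close> stands for the point \<open>(x, y, z)\<close> with \<open>y = w $ p\<close>, \<open>z = w $ q\<close>, and \<open>x\<close> given by the
  remaining \<open>n - 2\<close> coordinates.  A product \<open>real ^ 'm \<times> real \<times> real\<close> would not do, because index
  types are nonempty and the case \<open>n = 2\<close> would be lost.
\<close>

text \<open>
  The vector \<open>x \<in> \<real>\<^bsup>n-2\<^esup>\<close>, embedded isometrically in \<open>\<real>\<^sup>n\<close> with zeros at the positions \<open>p\<close> and \<open>q\<close>.
\<close>
definition x_part :: "'n \<Rightarrow> 'n \<Rightarrow> real ^ 'n \<Rightarrow> real ^ ('n::finite)" where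
  "x_part p q w = (\<chi> k. if k = p \<or> k = q then 0 else w $ k)"

definition trunc_cone :: "'n \<Rightarrow> 'n \<Rightarrow> real \<Rightarrow> (real ^ ('n::finite)) set" where
  "trunc_cone p q u =
     {w. 0 \<le> w $ p \<and> 0 \<le> w $ q \<and> (norm (x_part p q w))\<^sup>2 \<le> 2 * w $ p * w $ q \<and> w $ q \<le> u}"

end

theory Submission imports Defs
begin

text \<open>
  Let \<open>v\<close> be \<open>w\<close> with its \<open>q\<close>-coordinate replaced by \<open>u\<close>, so that \<open>w - v = (w $ q - u) e\<^sub>q\<close>.

  If \<open>u \<le> w $ q\<close>, every point \<open>s\<close> of the truncated cone lies in the half-space \<open>s $ q \<le> u\<close>, and \<open>v\<close> is
  the unique nearest point to \<open>w\<close> of that half-space.  The inequality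
  \<open>\<parallel>x\<parallel>\<^sup>2 \<le> 2 u y\<close> says exactly that \<open>v\<close> belongs to the truncated cone, so \<open>v\<close> is the projection.

  Conversely, let \<open>v\<close> be the projection.  As the truncated cone is closed, \<open>v\<close> lies in it, which is the
  inequality \<open>\<parallel>x\<parallel>\<^sup>2 \<le> 2 u y\<close>.  The truncated cone is star-shaped about the origin, so \<open>v\<close>
  is also the nearest point to \<open>w\<close> of the segment from \<open>0\<close> to \<open>v\<close>.  The obtuse angle criterion on that
  segment reads \<open>0 \<le> (w - v) \<bullet> v = (w $ q - u) u\<close>, hence \<open>u \<le> w $ q\<close>.  Moving towards the origin
  avoids any distinction between \<open>v\<close> on the quadratic boundary and \<open>v\<close> off it.
\<close>

lemma closed_trunc_cone: "closed (trunc_cone p q u)"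
proof -
  have "continuous_on UNIV (\<lambda>w. x_part p q w $ k)" for k
    by (cases "k = p \<or> k = q") (auto simp: x_part_def intro!: continuous_intros)
  then have "continuous_on UNIV (x_part p q)"
    by (subst continuous_on_componentwise)
       (auto simp: Basis_vec_def inner_axis)
  then show ?thesis
    unfolding trunc_cone_def by (intro closed_Collect_conj closed_Collect_le continuous_intros)
qed

lemma scaleR_mem_trunc_cone:
  assumes "v \<in> trunc_cone p q u" "0 \<le> t" "t \<le> 1"
  shows "t *\<^sub>R v \<in> trunc_cone p q u"
proof -
  have "x_part p q (t *\<^sub>R v) = t *\<^sub>R x_part p q v"
    by (simp add: x_part_def vec_eq_iff)
  moreover have "t\<^sup>2 * (norm (x_part p q v))\<^sup>2 \<le> t\<^sup>2 * (2 * v $ p * v $ q)"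
    using assms by (intro mult_left_mono) (auto simp: trunc_cone_def)
  moreover have "t * v $ q \<le> v $ q"
    using assms by (intro mult_left_le_one_le) (auto simp: trunc_cone_def)
  ultimately show ?thesis
    using assms by (auto simp: trunc_cone_def power_mult_distrib power2_eq_square mult_ac)
qed

text \<open>
  The obtuse angle criterion needs a convex set; the segment from the origin to the nearest point
  is one, and star-shapedness keeps it inside \<open>S\<close>.
\<close>
lemma closest_point_dot_nonneg_of_star_shaped:
  fixes a :: "'a::euclidean_space"
  assumes "closed S" "S \<noteq> {}"
    and star: "\<And>v t. v \<in> S \<Longrightarrow> 0 \<le> t \<Longrightarrow> t \<le> 1 \<Longrightarrow> t *\<^sub>R v \<in> S"
  shows "0 \<le> (a - closest_point S a) \<bullet> closest_point S a"
proof -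
  let ?v = "closest_point S a"
  have "?v \<in> S" using assms by (simp add: closest_point_in_set)
  then have "closed_segment 0 ?v \<subseteq> S"
    using star by (auto simp: closed_segment_def)
  then have "\<forall>z \<in> closed_segment 0 ?v. dist a ?v \<le> dist a z"
    using closest_point_le[OF \<open>closed S\<close>] by blast
  then have "(a - ?v) \<bullet> (0 - ?v) \<le> 0"
    by (intro any_closest_point_dot[of "closed_segment 0 ?v"]) auto
  then show ?thesis by simp
qed

text \<open>
  The nearest point to \<open>w\<close> of the half-space \<open>s $ q \<le> u\<close> is unique: as \<open>u \<le> w $ q\<close>, the \<open>q\<close>-coordinate alone already costs
  \<open>w $ q - u\<close>, so a point at that distance must agree with \<open>w\<close> in every other coordinate.
\<close>
lemma closest_point_upper_bounded_coordinate:
  fixes w :: "real ^ ('n::finite)"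
  assumes "closed S" and bound: "\<And>s. s \<in> S \<Longrightarrow> s $ q \<le> u" and "u \<le> w $ q"
    and mem: "(\<chi> k. if k = q then u else w $ k) \<in> S"
  shows "closest_point S w = (\<chi> k. if k = q then u else w $ k)"
proof -
  let ?v = "\<chi> k. if k = q then u else w $ k"
  let ?c = "closest_point S w"
  have "?c \<in> S" using assms closest_point_in_set by blast
  then have cq: "?c $ q \<le> u" by (rule bound)
  have diff: "w - ?v = axis q (w $ q - u)"
    by (auto simp: vec_eq_iff axis_def)
  have "dist w ?c \<le> dist w ?v"
    using closest_point_le[OF \<open>closed S\<close> mem] .
  then have "(norm (w - ?c))\<^sup>2 \<le> (norm (w - ?v))\<^sup>2"
    by (simp add: dist_norm power_mono)
  also have "\<dots> = (w $ q - u)\<^sup>2"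
    unfolding diff power2_norm_eq_inner by (simp add: inner_axis_axis power2_eq_square)
  finally have "(\<Sum>k\<in>UNIV. ((w - ?c) $ k)\<^sup>2) \<le> (w $ q - u)\<^sup>2"
    unfolding power2_norm_eq_inner by (simp add: inner_vec_def power2_eq_square)
  then have le: "(w $ q - ?c $ q)\<^sup>2 + (\<Sum>k\<in>UNIV - {q}. (w $ k - ?c $ k)\<^sup>2) \<le> (w $ q - u)\<^sup>2"
    by (simp add: sum.remove[of UNIV q])
  have ge: "(w $ q - u)\<^sup>2 \<le> (w $ q - ?c $ q)\<^sup>2"
    using cq \<open>u \<le> w $ q\<close> by (intro power_mono) auto
  have rest: "0 \<le> (\<Sum>k\<in>UNIV - {q}. (w $ k - ?c $ k)\<^sup>2)"
    by (rule sum_nonneg) simp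
  have "(\<Sum>k\<in>UNIV - {q}. (w $ k - ?c $ k)\<^sup>2) = 0"
    using le ge rest by linarith
  then have other: "?c $ k = w $ k" if "k \<noteq> q" for k
    using that by (simp add: sum_nonneg_eq_0_iff)
  have "(w $ q - ?c $ q)\<^sup>2 = (w $ q - u)\<^sup>2"
    using le ge rest by linarith
  then have "?c $ q = u"
    using cq \<open>u \<le> w $ q\<close> by (simp add: power2_eq_iff_nonneg)
  with other show ?thesis by (simp add: vec_eq_iff)
qed

text \<open>
  If \<open>y\<close> were negative then \<open>\<parallel>x\<parallel>\<^sup>2 \<le> 2 u y\<close> would fail, so this one inequality also
  contains the sign condition on \<open>y\<close>.
\<close>
lemma lifted_mem_trunc_cone_iff:
  assumes "p \<noteq> q" and "u > 0"
  shows "(\<chi> k. if k = q then u else w $ k) \<in> trunc_cone p q u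
           \<longleftrightarrow> (norm (x_part p q w))\<^sup>2 \<le> 2 * u * w $ p"
proof -
  have "x_part p q (\<chi> k. if k = q then u else w $ k) = x_part p q w"
    by (auto simp: x_part_def vec_eq_iff)
  moreover have "0 \<le> w $ p" if "(norm (x_part p q w))\<^sup>2 \<le> 2 * u * w $ p"
  proof -
    have "0 \<le> (2 * u) * w $ p" by (rule order_trans[OF zero_le_power2 that])
    then show ?thesis using \<open>u > 0\<close> by (simp add: zero_le_mult_iff)
  qed
  ultimately show ?thesis
    using assms by (auto simp: trunc_cone_def mult_ac)
qed

theorem lemma2:
  fixes p q :: "'n::finite" and u :: real and w :: "real ^ 'n"
  assumes "p \<noteq> q" and "u > 0"
  shows "(norm (x_part p q w))\<^sup>2 \<le> 2 * u * w $ p \<and> u \<le> w $ q \<longleftrightarrow>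
         closest_point (trunc_cone p q u) w = (\<chi> k. if k = q then u else w $ k)"
proof -
  let ?P = "trunc_cone p q u" and ?v = "\<chi> k. if k = q then u else w $ k"
  note mem_iff = lifted_mem_trunc_cone_iff[OF assms, of w]
  have "x_part p q 0 = 0"
    by (simp add: x_part_def vec_eq_iff)
  then have "0 \<in> ?P"
    using \<open>u > 0\<close> by (simp add: trunc_cone_def)
  then have nonempty: "?P \<noteq> {}" by blast
  show ?thesis
  proof
    assume "(norm (x_part p q w))\<^sup>2 \<le> 2 * u * w $ p \<and> u \<le> w $ q"
    then show "closest_point ?P w = ?v"
      using mem_iff
      by (intro closest_point_upper_bounded_coordinate closed_trunc_cone)
         (auto simp: trunc_cone_def)
  next
    assume proj: "closest_point ?P w = ?v"
    have "?v \<in> ?P"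
      using closest_point_in_set[OF closed_trunc_cone nonempty, of w] proj by simp
    moreover have "0 \<le> (w - ?v) \<bullet> ?v"
      using closest_point_dot_nonneg_of_star_shaped[OF closed_trunc_cone nonempty, of w]
        scaleR_mem_trunc_cone proj by metis
    moreover have "w - ?v = axis q (w $ q - u)"
      by (auto simp: vec_eq_iff axis_def)
    then have "(w - ?v) \<bullet> ?v = (w $ q - u) * u"
      by (simp add: inner_axis')
    ultimately show "(norm (x_part p q w))\<^sup>2 \<le> 2 * u * w $ p \<and> u \<le> w $ q"
      using mem_iff \<open>u > 0\<close> by (simp add: zero_le_mult_iff)
  qed
qed

end
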